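(* Let $1\le s\le d$ be integers and $a,\sigma>0$. (1) For any $s\ge1$ and $0<\delta<1$, $$\inf_{\hat S\in\mathcal F(\delta)}\ \sup_{\theta\in\Theta(s,a)}\mathbb P_\theta(\mathrm{supp}(\theta)\not\subseteq\hat S)\ge1-\frac1{(\Delta_{TS}+1)^s},$$ where $\Delta_{TS}=\Phi\big(\Phi^{-1}(\frac{1+\delta}2)+\frac a\sigma\big)-\Phi\big(-\Phi^{-1}(\frac{1+\delta}2)+\frac a\sigma\big)$. (2) Assume that $s,d\to\infty$. Let $c_s$ be a sequence satisfying $c_s\to\infty$ and $c_s/s\to0$, and assume that $\delta\ge c$ for some constant $c>0$. If $$\frac a\sigma\le\phi_*:=\Phi^{-1}\Big(\frac{1+\delta}2\Big)-\Phi^{-1}\Big(\frac{c_s}s\Big),$$ then $$\liminf_{d,s\to\infty}\ \inf_{\hat S\in\mathcal F(\delta)}\ \sup_{\theta\in\Theta(s,a)}\mathbb P_\theta(\mathrm{supp}(\theta)\not\subseteq\hat S)=1.$$ (3) For any $0<\alpha'<1$, the set $$\hat S^{TS}_{\alpha'}=\Big\{j\in[d]:\ \frac{|X_j|}\sigma\ge\Big(\Phi^{-1}\big(\tfrac{\alpha'}{2s}\big)+\frac a\sigma\Big)_+\vee\Phi^{-1}\Big(\frac{1+\delta}2\Big)\Big\}$$ satisfies $\hat S^{TS}_{\alpha'}\in\mathcal F(\delta)$. In addition, if $$\frac a\sigma\ge\phi^*:=\Phi^{-1}\Big(\frac{\delta+1}2\Big)-\Phi^{-1}\Big(\frac{\alpha'}{2s}\Big),$$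 then $$\sup_{\theta\in\Theta(s,a)}\mathbb P_\theta(\mathrm{supp}(\theta)\not\subseteq\hat S^{TS}_{\alpha'})\le\alpha'.$$
   Context: $X=(X_1,\dots,X_d)\sim N(\theta,\sigma^2 I_d)$ with $\theta\in\mathbb R^d$ unknown and $\sigma>0$ known; $\mathbb P_\theta$ is the corresponding probability. $\Phi$ is the standard normal c.d.f., $x\vee y=\max(x,y)$, $(x)_+=\max(x,0)$, $[d]=\{1,\dots,d\}$, $\mathrm{supp}(\theta)=\{j:\theta_j\ne0\}$, $\|\theta\|_0=|\mathrm{supp}(\theta)|$. The parameter space is $$\Theta(s,a)=\{\theta\in\mathbb R^d:\ \|\theta\|_0\le s,\ \min_{j:\theta_j\neq0}|\theta_j|\ge a\}.$$ $\mathcal F(\delta)$, $0<\delta<1$, is the class of (measurable) random subsets $S=S(X)\subseteq[d]$ such that for every $j\in[d]$: the event $\{j\in S(X)\}$ depends only on $X_j$, and $\mathbb P_0(j\in S(X))\le1-\delta$, where $\mathbb P_0$ is the probability when $X_j\sim N(0,\sigma^2)$. In asymptotic statements, $s\le d$ and $a,\sigma$ may depend on $(d,s)$. *)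

theory Defs
  imports "HOL-Probability.Probability"
begin

definition Phi :: "real \<Rightarrow> real" where
  "Phi = cdf std_normal_distribution"

text \<open>\<open>Phi\<close> is a bijection from the reals onto the open unit interval, so the following is
  meaningful only at arguments strictly between \<open>0\<close> and \<open>1\<close>.\<close>

definition Phi_inv :: "real \<Rightarrow> real" where
  "Phi_inv = inv Phi"

text \<open>Vectors in \<open>d\<close>-dimensional space are the extensional functions in \<open>{1..d} \<rightarrow>\<^sub>E UNIV\<close>, which
  is also the sample space of the product measure below. The law of an observation with
  independent components \<open>N(\<theta> j, \<sigma>\<^sup>2)\<close> (the second argument of
  \<^const>\<open>normal_density\<close> is the standard deviation):\<close>

definition obs_law :: "nat \<Rightarrow> real \<Rightarrow> (nat \<Rightarrow> real) \<Rightarrow> (nat \<Rightarrow> real) measure" where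
  "obs_law d \<sigma> \<theta> = (\<Pi>\<^sub>M j\<in>{1..d}. density lborel (normal_density (\<theta> j) \<sigma>))"

definition supp :: "nat \<Rightarrow> (nat \<Rightarrow> real) \<Rightarrow> nat set" where
  "supp d \<theta> = {j \<in> {1..d}. \<theta> j \<noteq> 0}"

definition Theta :: "nat \<Rightarrow> nat \<Rightarrow> real \<Rightarrow> (nat \<Rightarrow> real) set" where
  "Theta d s a = {\<theta> \<in> {1..d} \<rightarrow>\<^sub>E UNIV. card (supp d \<theta>) \<le> s \<and> (\<forall>j\<in>supp d \<theta>. a \<le> \<bar>\<theta> j\<bar>)}"

text \<open>The event \<open>j \<in> S(X)\<close> depends only on \<open>X\<^sub>j\<close>: it belongs to the sigma-algebra generated by
  the \<open>j\<close>-th coordinate.\<close>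

definition selectors :: "nat \<Rightarrow> real \<Rightarrow> real \<Rightarrow> ((nat \<Rightarrow> real) \<Rightarrow> nat set) set" where
  "selectors d \<sigma> \<delta> = {S.
     (\<forall>x \<in> {1..d} \<rightarrow>\<^sub>E UNIV. S x \<subseteq> {1..d}) \<and>
     (\<forall>j\<in>{1..d}.
        {x \<in> {1..d} \<rightarrow>\<^sub>E UNIV. j \<in> S x}
          \<in> sets (vimage_algebra ({1..d} \<rightarrow>\<^sub>E UNIV) (\<lambda>x. x j) borel) \<and>
        measure (obs_law d \<sigma> (\<lambda>i\<in>{1..d}. 0)) {x \<in> {1..d} \<rightarrow>\<^sub>E UNIV. j \<in> S x} \<le> 1 - \<delta>)}"

definition miss_prob ::
  "nat \<Rightarrow> real \<Rightarrow> (nat \<Rightarrow> real) \<Rightarrow> ((nat \<Rightarrow> real) \<Rightarrow> nat set) \<Rightarrow> real" where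
  "miss_prob d \<sigma> \<theta> S = measure (obs_law d \<sigma> \<theta>) {x \<in> {1..d} \<rightarrow>\<^sub>E UNIV. \<not> supp d \<theta> \<subseteq> S x}"

text \<open>The infimum and suprema of reals here are over nonempty sets of probabilities (the zero
  vector lies in \<open>Theta\<close>, the empty selector in \<open>selectors\<close> when \<open>\<delta> \<le> 1\<close>).\<close>

definition sup_miss_prob ::
  "nat \<Rightarrow> nat \<Rightarrow> real \<Rightarrow> real \<Rightarrow> ((nat \<Rightarrow> real) \<Rightarrow> nat set) \<Rightarrow> real" where
  "sup_miss_prob d s a \<sigma> S = (SUP \<theta>\<in>Theta d s a. miss_prob d \<sigma> \<theta> S)"

definition minimax_risk :: "nat \<Rightarrow> nat \<Rightarrow> real \<Rightarrow> real \<Rightarrow> real \<Rightarrow> real" where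
  "minimax_risk d s a \<sigma> \<delta> = (INF S\<in>selectors d \<sigma> \<delta>. sup_miss_prob d s a \<sigma> S)"

definition Delta_TS :: "real \<Rightarrow> real \<Rightarrow> real \<Rightarrow> real" where
  "Delta_TS a \<sigma> \<delta> =
     Phi (Phi_inv ((1 + \<delta>) / 2) + a / \<sigma>) - Phi (- Phi_inv ((1 + \<delta>) / 2) + a / \<sigma>)"

definition S_TS ::
  "nat \<Rightarrow> nat \<Rightarrow> real \<Rightarrow> real \<Rightarrow> real \<Rightarrow> real \<Rightarrow> (nat \<Rightarrow> real) \<Rightarrow> nat set" where
  "S_TS d s a \<sigma> \<delta> \<alpha> x = {j \<in> {1..d}.
     \<bar>x j\<bar> / \<sigma> \<ge> max (max (Phi_inv (\<alpha> / (2 * real s)) + a / \<sigma>) 0) (Phi_inv ((1 + \<delta>) / 2))}"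

text \<open>The joint limit of \<open>(d, s)\<close> with both components tending to infinity, subject to \<open>s \<le> d\<close>.\<close>

definition ds_at_top :: "(nat \<times> nat) filter" where
  "ds_at_top = inf (at_top \<times>\<^sub>F at_top) (principal {(d, s). s \<le> d})"

end

theory Submission
  imports Defs
begin

text \<open>
  For a selector with acceptance regions \<open>A\<^sub>j\<close>, the miss probability at \<open>\<theta>\<close> is one minus the product
  of the detection probabilities over the support. The likelihood ratio of the symmetric mixture of
  \<open>N(\<plusminus>a, \<sigma>\<^sup>2)\<close> against \<open>N(0, \<sigma>\<^sup>2)\<close> increases with \<open>\<bar>x\<bar>\<close>, so by Neyman--Pearson no \<open>A\<^sub>j\<close> of level
  \<open>1 - \<delta>\<close> beats the two-sided test \<open>\<bar>x\<bar> \<ge> \<sigma>t\<close>, \<open>t = \<Phi>\<inverse>((1 + \<delta>) / 2)\<close>, on average over the two signs.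
  Choosing for each \<open>j \<le> s\<close> the worse sign bounds the product by \<open>(1 - \<Delta>)\<^sup>s \<le> (1 + \<Delta>)\<^sup>-\<^sup>s\<close>.
  For the asymptotics, \<open>\<Delta>\<close> decreases in \<open>a / \<sigma>\<close>, and a Gaussian tail comparison gives
  \<open>\<Delta> \<ge> \<kappa> c\<^sub>s / s\<close> with \<open>\<kappa> > 0\<close> depending only on the lower bound for \<open>\<delta>\<close>, so that \<open>(1 + \<Delta>)\<^sup>s\<close>
  diverges. The upper bound is a union bound.
\<close>

section \<open>Normal laws on the line and calculus of \<open>Phi\<close>\<close>

abbreviation normal_law :: "real \<Rightarrow> real \<Rightarrow> real measure" where
  "normal_law \<mu> \<sigma> \<equiv> density lborel (normal_density \<mu> \<sigma>)"

lemma integrable_indicator_normal_density: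
  assumes "0 < \<sigma>" "A \<in> sets borel"
  shows "integrable lborel (\<lambda>x. indicator A x * normal_density \<mu> \<sigma> x)"
  using integrable_real_mult_indicator[of A lborel "normal_density \<mu> \<sigma>"] assms
  by (simp add: mult.commute)

lemma measure_normal_law:
  assumes "A \<in> sets borel"
  shows "measure (normal_law \<mu> \<sigma>) A = (\<integral>x. indicator A x * normal_density \<mu> \<sigma> x \<partial>lborel)"
proof -
  have "measure (normal_law \<mu> \<sigma>) A = (\<integral>x. indicator A x \<partial>normal_law \<mu> \<sigma>)"
    using assms by simp
  also have "\<dots> = (\<integral>x. normal_density \<mu> \<sigma> x * indicator A x \<partial>lborel)"
    using assms by (subst integral_density) auto
  finally show ?thesis by (simp add: mult.commute)
qed

lemma Phi_tendsto_at_top: "(Phi \<longlongrightarrow> 1) at_top"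
  and Phi_tendsto_at_bot: "(Phi \<longlongrightarrow> 0) at_bot"
proof -
  interpret real_distribution std_normal_distribution by (rule real_dist_normal_dist)
  show "(Phi \<longlongrightarrow> 1) at_top" "(Phi \<longlongrightarrow> 0) at_bot"
    unfolding Phi_def by (rule cdf_lim_at_top_prob, rule cdf_lim_at_bot)
qed

lemma Phi_nonneg: "0 \<le> Phi x" and Phi_le_1: "Phi x \<le> 1"
proof -
  interpret real_distribution std_normal_distribution by (rule real_dist_normal_dist)
  show "0 \<le> Phi x" "Phi x \<le> 1"
    unfolding Phi_def by (rule cdf_nonneg, rule cdf_bounded_prob)
qed

lemma continuous_on_std_normal_density: "continuous_on A std_normal_density"
  unfolding normal_density_def by (intro continuous_intros) auto

text \<open>The density form of \<open>Phi\<close> over a compact interval, which opens the way to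
  the fundamental theorem of calculus.\<close>

lemma Phi_diff_eq_integral:
  assumes "a \<le> x" shows "Phi x - Phi a = integral {a..x} std_normal_density"
proof -
  interpret real_distribution std_normal_distribution by (rule real_dist_normal_dist)
  have int: "set_integrable lborel {a<..x} std_normal_density"
    unfolding set_integrable_def using integrable_indicator_normal_density[of 1 "{a<..x}" 0] by simp
  have "Phi x - Phi a = measure std_normal_distribution {a<..x}"
    using assms by (cases "a = x") (simp_all add: Phi_def cdf_diff_eq)
  also have "\<dots> = integral {a<..x} std_normal_density"
    using set_borel_integral_eq_integral(2)[OF int]
    by (simp add: measure_normal_law set_lebesgue_integral_def)
  \<comment> \<open>The half-open and the closed interval differ by one point, which is
    negligible.\<close>
  also have "\<dots> = integral {a..x} std_normal_density"
    by (rule integral_subset_negligible) (auto intro: negligible_subset[of "{a}"])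
  finally show ?thesis .
qed

text \<open>On the window of radius 1 around \<open>x\<close>, \<open>Phi\<close> is a constant plus
  an integral with moving upper end. Since \<open>x\<close> is interior, the derivative within the
  window is the full derivative.\<close>

lemma DERIV_Phi: "(Phi has_real_derivative std_normal_density x) (at x)"
proof -
  have "((\<lambda>u. Phi (x - 1) + integral {x - 1..u} std_normal_density)
      has_real_derivative std_normal_density x) (at x within {x - 1..x + 1})"
    using DERIV_add[OF DERIV_const integral_has_real_derivative[OF continuous_on_std_normal_density]]
    by simp
  then have "(Phi has_real_derivative std_normal_density x) (at x within {x - 1..x + 1})"
    by (rule has_field_derivative_transform_within[of _ _ _ _ 1])
      (auto simp: Phi_diff_eq_integral[symmetric])
  then show ?thesis
    by (simp add: at_within_Icc_at)
qed

lemmas DERIV_Phi_chain [derivative_intros] = DERIV_chain2[OF DERIV_Phi]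

lemma strict_mono_Phi: "strict_mono Phi"
  by (intro strict_monoI DERIV_pos_imp_increasing[of _ _ Phi])
    (use DERIV_Phi normal_density_pos[of 1 0] in auto)

lemmas Phi_less_iff [simp] = strict_mono_less[OF strict_mono_Phi]
  and Phi_le_iff [simp] = strict_mono_less_eq[OF strict_mono_Phi]

lemma isCont_Phi: "isCont Phi x"
  using DERIV_Phi by (rule DERIV_isCont)

text \<open>The density is even, so \<open>Phi y + Phi (- y)\<close> has derivative zero; its
  constant value is read off at infinity.\<close>

lemma Phi_minus: "Phi (- x) = 1 - Phi x"
proof -
  have "((\<lambda>y. Phi y + Phi (- y)) has_real_derivative 0) (at y)" for y
    by (auto intro!: derivative_eq_intros simp: std_normal_density_def)
  then have "(\<lambda>y. Phi y + Phi (- y)) = (\<lambda>_. Phi x + Phi (- x))"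
    by (intro ext DERIV_isconst_all[of "\<lambda>y. Phi y + Phi (- y)"]) auto
  moreover have "((\<lambda>y. Phi y + Phi (- y)) \<longlongrightarrow> 1 + 0) at_top"
    by (intro tendsto_add Phi_tendsto_at_top
        filterlim_compose[OF Phi_tendsto_at_bot filterlim_uminus_at_bot_at_top])
  ultimately have "Phi x + Phi (- x) = 1"
    by (simp add: tendsto_const_iff)
  then show ?thesis
    by simp
qed

lemma Phi_zero: "Phi 0 = 1 / 2"
  using Phi_minus[of 0] by simp

text \<open>The limits 0 and 1 at the two ends and the intermediate value theorem place
  \<open>p\<close> in the range of \<open>Phi\<close>, where \<open>inv\<close> is a right
  inverse.\<close>

lemma Phi_Phi_inv:
  assumes "0 < p" "p < 1"
  shows "Phi (Phi_inv p) = p"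
proof -
  obtain x where x: "Phi x < p"
    using order_tendstoD(2)[OF Phi_tendsto_at_bot assms(1)]
    by (auto simp: eventually_at_bot_linorder)
  obtain y where y: "p < Phi y"
    using order_tendstoD(1)[OF Phi_tendsto_at_top assms(2)]
    by (auto simp: eventually_at_top_linorder)
  have "x \<le> y"
    using x y by (smt (verit) Phi_less_iff)
  then obtain z where "Phi z = p"
    using IVT[of Phi x p y] x y isCont_Phi by force
  then show ?thesis
    unfolding Phi_inv_def by (metis f_inv_into_f rangeI)
qed

lemma Phi_inv_mono:
  assumes "0 < p" "p \<le> q" "q < 1"
  shows "Phi_inv p \<le> Phi_inv q"
  using assms Phi_le_iff[of "Phi_inv p" "Phi_inv q"] by (simp add: Phi_Phi_inv)

lemma Phi_inv_pos_iff: "0 < p \<Longrightarrow> p < 1 \<Longrightarrow> 0 < Phi_inv p \<longleftrightarrow> 1 / 2 < p"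
  using Phi_less_iff[of 0 "Phi_inv p"] by (simp add: Phi_Phi_inv Phi_zero)

text \<open>The difference of the two sides is nonincreasing in \<open>q \<ge> 0\<close> and vanishes at infinity.\<close>

lemma Phi_tail_shift:
  assumes "0 \<le> q" "0 \<le> h"
  shows "1 - Phi (q + h) \<le> exp (- h\<^sup>2 / 2) * (1 - Phi q)"
proof -
  define g where "g = (\<lambda>y. exp (- h\<^sup>2 / 2) * (1 - Phi y) - (1 - Phi (y + h)))"
  have deriv: "(g has_real_derivative
      - exp (- h\<^sup>2 / 2) * std_normal_density y + std_normal_density (y + h)) (at y)" for y
    unfolding g_def by (auto intro!: derivative_eq_intros)
  \<comment> \<open>Expanding the square leaves the cross term \<open>y * h\<close>, which is
    nonnegative here.\<close>
  have le: "std_normal_density (y + h) \<le> exp (- h\<^sup>2 / 2) * std_normal_density y" if "0 \<le> y" for y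
  proof -
    have "exp (- (y + h)\<^sup>2 / 2) \<le> exp (- h\<^sup>2 / 2) * exp (- y\<^sup>2 / 2)"
      using that assms by (simp add: mult_exp_exp power2_sum field_simps)
    then show ?thesis
      unfolding std_normal_density_def by (simp add: field_simps)
  qed
  have "g y \<le> g q" if "q \<le> y" for y
    using that
  proof (rule DERIV_nonpos_imp_nonincreasing)
    fix x assume "q \<le> x"
    then show "\<exists>D. (g has_real_derivative D) (at x) \<and> D \<le> 0"
      using deriv le[of x] assms by (intro exI[of _ "- exp (- h\<^sup>2 / 2) * std_normal_density x + std_normal_density (x + h)"]) auto
  qed
  then have "eventually (\<lambda>y. g y \<le> g q) at_top"
    by (auto simp: eventually_at_top_linorder)
  moreover have "(g \<longlongrightarrow> exp (- h\<^sup>2 / 2) * (1 - 1) - (1 - 1)) at_top"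
    unfolding g_def
    by (intro tendsto_intros Phi_tendsto_at_top filterlim_compose[OF Phi_tendsto_at_top]
        filterlim_tendsto_add_at_top[OF tendsto_const filterlim_ident, of h, simplified add.commute])
  ultimately have "0 \<le> g q"
    using tendsto_upperbound by fastforce
  then show ?thesis
    by (simp add: g_def)
qed

text \<open>A window of half-width \<open>t\<close> loses mass as its centre moves away from 0: for
  a centre \<open>x >= 0\<close> the right end is at least as far from the origin as the left end,
  so the density there is no larger.\<close>

lemma Phi_window_antimono:
  assumes "0 \<le> t" "0 \<le> u" "u \<le> v"
  shows "Phi (t + v) - Phi (- t + v) \<le> Phi (t + u) - Phi (- t + u)"
  using assms(3)
proof (rule DERIV_nonpos_imp_nonincreasing)
  fix x assume "u \<le> x"
  with assms have "std_normal_density (t + x) \<le> std_normal_density (- t + x)"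
    by (auto simp: std_normal_density_def field_simps power2_sum power2_diff)
  then show "\<exists>D. ((\<lambda>u. Phi (t + u) - Phi (- t + u)) has_real_derivative D) (at x) \<and> D \<le> 0"
    by (intro exI[of _ "std_normal_density (t + x) - std_normal_density (- t + x)"])
      (auto intro!: derivative_eq_intros)
qed

section \<open>Normal probabilities of half-lines and symmetric intervals\<close>

text \<open>Standardisation: the law is pushed forward along \<open>(x - \<mu>) / \<sigma>\<close>,
  under which half-lines pull back to half-lines.\<close>

lemma measure_normal_law_atMost:
  assumes "0 < \<sigma>"
  shows "measure (normal_law \<mu> \<sigma>) {..x} = Phi ((x - \<mu>) / \<sigma>)"
proof -
  interpret prob_space "normal_law \<mu> \<sigma>"
    using assms by (rule prob_space_normal_density)
  have "distributed (normal_law \<mu> \<sigma>) lborel (\<lambda>x. x) (normal_density \<mu> \<sigma>)"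
    by (auto simp: distributed_def distr_id2)
  then have "distributed (normal_law \<mu> \<sigma>) lborel (\<lambda>x. (x - \<mu>) / \<sigma>) std_normal_density"
    using normal_standard_normal_convert[OF assms] by simp
  then have "std_normal_distribution = distr (normal_law \<mu> \<sigma>) lborel (\<lambda>x. (x - \<mu>) / \<sigma>)"
    by (simp add: distributed_def)
  then have "Phi ((x - \<mu>) / \<sigma>) =
      measure (normal_law \<mu> \<sigma>) ((\<lambda>x. (x - \<mu>) / \<sigma>) -` {..(x - \<mu>) / \<sigma>} \<inter> UNIV)"
    unfolding Phi_def cdf_def by (simp add: measure_distr)
  also have "(\<lambda>x. (x - \<mu>) / \<sigma>) -` {..(x - \<mu>) / \<sigma>} \<inter> UNIV = {..x}"
    using assms by (auto simp: divide_le_cancel)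
  finally show ?thesis ..
qed

lemma measure_normal_law_abs_less:
  assumes "0 < \<sigma>" "0 \<le> r"
  shows "measure (normal_law \<mu> \<sigma>) {x. \<bar>x\<bar> / \<sigma> < r} = Phi (r - \<mu> / \<sigma>) - Phi (- r - \<mu> / \<sigma>)"
proof -
  interpret prob_space "normal_law \<mu> \<sigma>"
    using assms(1) by (rule prob_space_normal_density)
  \<comment> \<open>The two sets can differ only at \<open>\<sigma> * r\<close>, a null
    point.\<close>
  have "measure (normal_law \<mu> \<sigma>) {x. \<bar>x\<bar> / \<sigma> < r} = measure (normal_law \<mu> \<sigma>) ({..\<sigma> * r} - {..- (\<sigma> * r)})"
  proof (rule measure_eq_AE)
    have "AE x in normal_law \<mu> \<sigma>. x \<noteq> \<sigma> * r"
      using AE_lborel_singleton[of "\<sigma> * r"] by (auto simp: AE_density)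
    then show "AE x in normal_law \<mu> \<sigma>. x \<in> {x. \<bar>x\<bar> / \<sigma> < r} \<longleftrightarrow> x \<in> {..\<sigma> * r} - {..- (\<sigma> * r)}"
    proof eventually_elim
      case (elim x)
      then show ?case
        using assms by (auto simp: field_simps abs_less_iff)
    qed
  qed auto
  also have "\<dots> = measure (normal_law \<mu> \<sigma>) {..\<sigma> * r} - measure (normal_law \<mu> \<sigma>) {..- (\<sigma> * r)}"
    using assms by (intro finite_measure_Diff) (auto intro: order_trans)
  also have "\<dots> = Phi (r - \<mu> / \<sigma>) - Phi (- r - \<mu> / \<sigma>)"
    using assms by (simp add: measure_normal_law_atMost diff_divide_distrib)
  finally show ?thesis .
qed

lemma measure_normal_law_abs_ge:
  assumes "0 < \<sigma>" "0 \<le> r"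
  shows "measure (normal_law \<mu> \<sigma>) {x. r \<le> \<bar>x\<bar> / \<sigma>} = 1 - (Phi (r - \<mu> / \<sigma>) - Phi (- r - \<mu> / \<sigma>))"
proof -
  interpret prob_space "normal_law \<mu> \<sigma>"
    using assms(1) by (rule prob_space_normal_density)
  have "{x. r \<le> \<bar>x\<bar> / \<sigma>} = space (normal_law \<mu> \<sigma>) - {x. \<bar>x\<bar> / \<sigma> < r}"
    by auto
  then show ?thesis
    using prob_compl[of "{x. \<bar>x\<bar> / \<sigma> < r}"] measure_normal_law_abs_less[OF assms, of \<mu>] by simp
qed

text \<open>One of the two \<open>Phi\<close> terms is dropped; for negative \<open>\<mu>\<close>
  reflection by \<open>Phi_minus\<close> first exchanges their roles. The bound depends on
  \<open>\<mu>\<close> only through its modulus, as the union bound over the support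
  requires.\<close>

lemma measure_normal_law_abs_less_le:
  assumes "0 < \<sigma>" "0 \<le> r"
  shows "measure (normal_law \<mu> \<sigma>) {x. \<bar>x\<bar> / \<sigma> < r} \<le> Phi (r - \<bar>\<mu>\<bar> / \<sigma>)"
proof (cases "0 \<le> \<mu>")
  case True
  then show ?thesis
    using Phi_nonneg[of "- r - \<mu> / \<sigma>"] by (simp add: measure_normal_law_abs_less[OF assms])
next
  case False
  then show ?thesis
    using Phi_nonneg[of "- (r - \<mu> / \<sigma>)"] Phi_minus[of "r - \<mu> / \<sigma>"] Phi_minus[of "r + \<mu> / \<sigma>"]
    by (simp add: measure_normal_law_abs_less[OF assms])
qed

section \<open>Likelihood ratio and the Neyman-Pearson comparison\<close>

text \<open>Completing the square writes each shifted density as an exponential tilt of the centred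
  one; the two opposite tilts add up to a \<open>cosh\<close>. As \<open>cosh\<close> is even, the
  ratio can be expressed in \<open>\<bar>x\<bar>\<close>.\<close>

lemma normal_density_pair:
  assumes "0 < \<sigma>"
  shows "normal_density a \<sigma> x + normal_density (- a) \<sigma> x
    = 2 * exp (- a\<^sup>2 / (2 * \<sigma>\<^sup>2)) * cosh (a * \<bar>x\<bar> / \<sigma>\<^sup>2) * normal_density 0 \<sigma> x"
proof -
  have *: "normal_density b \<sigma> x
      = exp (- b\<^sup>2 / (2 * \<sigma>\<^sup>2)) * exp (b * x / \<sigma>\<^sup>2) * normal_density 0 \<sigma> x" for b
  proof -
    have "- (x - b)\<^sup>2 / (2 * \<sigma>\<^sup>2) = - b\<^sup>2 / (2 * \<sigma>\<^sup>2) + b * x / \<sigma>\<^sup>2 + - (x - 0)\<^sup>2 / (2 * \<sigma>\<^sup>2)"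
      using assms by (simp add: power2_diff field_simps)
    then have "exp (- (x - b)\<^sup>2 / (2 * \<sigma>\<^sup>2))
        = exp (- b\<^sup>2 / (2 * \<sigma>\<^sup>2)) * exp (b * x / \<sigma>\<^sup>2) * exp (- (x - 0)\<^sup>2 / (2 * \<sigma>\<^sup>2))"
      by (simp only: exp_add)
    then show ?thesis
      unfolding normal_density_def by (simp only: mult.left_commute)
  qed
  have "cosh (a * \<bar>x\<bar> / \<sigma>\<^sup>2) = cosh (a * x / \<sigma>\<^sup>2)"
    by (cases "0 \<le> x") auto
  then show ?thesis
    using *[of a] *[of "- a"] by (simp only: cosh_field_def) (simp add: algebra_simps)
qed

text \<open>The sum of the two detection probabilities is twice the power against the equal mixture
  of both signs, so the two-sided test is the likelihood ratio test for it.\<close>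

lemma neyman_pearson_symmetric_normal:
  assumes "0 < \<sigma>" "0 < a" "0 \<le> t" and A: "A \<in> sets borel"
    and level: "measure (normal_law 0 \<sigma>) A \<le> measure (normal_law 0 \<sigma>) {x. t \<le> \<bar>x\<bar> / \<sigma>}"
  shows "measure (normal_law a \<sigma>) A + measure (normal_law (- a) \<sigma>) A
    \<le> measure (normal_law a \<sigma>) {x. t \<le> \<bar>x\<bar> / \<sigma>} + measure (normal_law (- a) \<sigma>) {x. t \<le> \<bar>x\<bar> / \<sigma>}"
proof -
  define B where "B = {x. t \<le> \<bar>x\<bar> / \<sigma>}"
  \<comment> \<open>The value of the ratio from \<open>normal_density_pair\<close> on the boundary
    \<open>\<bar>x\<bar> = \<sigma> * t\<close>; the factor 2 appears because the densities are
    summed, not averaged.\<close>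
  define k where "k = 2 * exp (- a\<^sup>2 / (2 * \<sigma>\<^sup>2)) * cosh (a * t / \<sigma>)"
  have B: "B \<in> sets borel"
    unfolding B_def by measurable
  define f where "f = (\<lambda>x. normal_density a \<sigma> x + normal_density (- a) \<sigma> x)"
  define g where "g = (\<lambda>C x. indicator C x * normal_density a \<sigma> x
    + indicator C x * normal_density (- a) \<sigma> x - k * (indicator C x * normal_density 0 \<sigma> x))"
  have g: "integrable lborel (g C)"
    "integral\<^sup>L lborel (g C) = measure (normal_law a \<sigma>) C + measure (normal_law (- a) \<sigma>) C
      - k * measure (normal_law 0 \<sigma>) C" if "C \<in> sets borel" for C
    using that assms(1)
    by (simp_all add: g_def integrable_indicator_normal_density measure_normal_law)
  have cosh_iff: "cosh (a * t / \<sigma>) \<le> cosh (a * \<bar>x\<bar> / \<sigma>\<^sup>2) \<longleftrightarrow> x \<in> B" for x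
    using assms(1-3) by (subst cosh_real_nonneg_le_iff) (auto simp: B_def field_simps power2_eq_square)
  have sign: "k * normal_density 0 \<sigma> x \<le> f x" if "x \<in> B" for x
    unfolding f_def k_def normal_density_pair[OF assms(1)] using that
    by (intro mult_right_mono mult_left_mono) (simp_all add: cosh_iff)
  have sign': "f x \<le> k * normal_density 0 \<sigma> x" if "x \<notin> B" for x
    unfolding f_def k_def normal_density_pair[OF assms(1)] using that cosh_iff[of x]
    by (intro mult_right_mono mult_left_mono) simp_all
  \<comment> \<open>\<open>B\<close> is where the likelihood ratio is at least \<open>k\<close>, so it maximises the integral of \<open>f - k f\<^sub>0\<close>,
    where \<open>f\<^sub>0\<close> is the null density.\<close>
  have "g A x \<le> g B x" for x
    using sign[of x] sign'[of x]
    by (auto simp: g_def f_def indicator_def)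
  then have "integral\<^sup>L lborel (g A) \<le> integral\<^sup>L lborel (g B)"
    using g A B by (intro integral_mono) auto
  \<comment> \<open>As \<open>k >= 0\<close>, the level constraint cancels the penalty terms in the
    compared integrals.\<close>
  moreover have "k * measure (normal_law 0 \<sigma>) A \<le> k * measure (normal_law 0 \<sigma>) B"
    using level by (intro mult_left_mono) (auto simp: B_def k_def)
  ultimately show ?thesis
    using g A B by (simp flip: B_def)
qed

section \<open>The product law and its cylinder events\<close>

lemma prob_space_obs_law: "0 < \<sigma> \<Longrightarrow> prob_space (obs_law d \<sigma> \<theta>)"
  unfolding obs_law_def by (intro prob_space_PiM prob_space_normal_density)

lemma space_obs_law: "space (obs_law d \<sigma> \<theta>) = {1..d} \<rightarrow>\<^sub>E UNIV"
  by (simp add: obs_law_def space_PiM)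

lemma sets_obs_law_cylinder:
  assumes "J \<subseteq> {1..d}" "\<And>j. j \<in> J \<Longrightarrow> A j \<in> sets borel"
  shows "{x \<in> {1..d} \<rightarrow>\<^sub>E UNIV. \<forall>j\<in>J. x j \<in> A j} \<in> sets (obs_law d \<sigma> \<theta>)"
proof -
  have "finite J"
    using assms(1) finite_subset by blast
  moreover have "{x \<in> {1..d} \<rightarrow>\<^sub>E UNIV. x j \<in> A j} \<in> sets (obs_law d \<sigma> \<theta>)" if "j \<in> J" for j
    using sets_Collect_single'[of j "{1..d}" "\<lambda>j. normal_law (\<theta> j) \<sigma>" "\<lambda>y. y \<in> A j"] assms that
    by (auto simp: obs_law_def space_PiM)
  ultimately show ?thesis
    using sets.sets_Collect_finite_All[of J "obs_law d \<sigma> \<theta>" "\<lambda>j x. x j \<in> A j"]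
    by (simp add: space_obs_law)
qed

text \<open>Independence, with total mass one in the coordinates outside \<open>J\<close>. It is
  applied to singletons for marginal statements and to \<open>{1..s}\<close> for joint
  detection.\<close>

lemma measure_obs_law_cylinder:
  assumes "0 < \<sigma>" "J \<subseteq> {1..d}" "\<And>j. j \<in> J \<Longrightarrow> A j \<in> sets borel"
  shows "measure (obs_law d \<sigma> \<theta>) {x \<in> {1..d} \<rightarrow>\<^sub>E UNIV. \<forall>j\<in>J. x j \<in> A j}
    = (\<Prod>j\<in>J. measure (normal_law (\<theta> j) \<sigma>) (A j))"
proof -
  interpret product_prob_space "\<lambda>j. normal_law (\<theta> j) \<sigma>" "{1..d}"
    by (intro product_prob_spaceI prob_space_normal_density assms)
  have "{x \<in> {1..d} \<rightarrow>\<^sub>E UNIV. \<forall>j\<in>J. x j \<in> A j}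
      = emb {1..d} J (Pi\<^sub>E J A)"
    using assms(2) by (auto simp: prod_emb_def PiE_def Pi_def)
  then show ?thesis
    unfolding obs_law_def using measure_PiM_emb[of J A] assms finite_subset[OF assms(2)] by simp
qed

section \<open>Miss probability, its supremum and the minimax risk\<close>

lemma miss_prob_nonneg: "0 \<le> miss_prob d \<sigma> \<theta> S"
  by (simp add: miss_prob_def)

lemma miss_prob_le_1: "0 < \<sigma> \<Longrightarrow> miss_prob d \<sigma> \<theta> S \<le> 1"
  unfolding miss_prob_def by (rule prob_space.prob_le_1[OF prob_space_obs_law])

lemma miss_prob_le_sup:
  assumes "0 < \<sigma>" "\<theta> \<in> Theta d s a"
  shows "miss_prob d \<sigma> \<theta> S \<le> sup_miss_prob d s a \<sigma> S"
  unfolding sup_miss_prob_def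
  using assms miss_prob_le_1 by (intro cSUP_upper bdd_aboveI2[of _ _ 1]) auto

lemma zero_in_Theta: "(\<lambda>j\<in>{1..d}. 0) \<in> Theta d s a"
proof -
  have "supp d (\<lambda>j\<in>{1..d}. 0) = {}"
    by (auto simp: supp_def)
  then show ?thesis
    by (simp add: Theta_def)
qed

lemma sup_miss_prob_le:
  assumes "\<And>\<theta>. \<theta> \<in> Theta d s a \<Longrightarrow> miss_prob d \<sigma> \<theta> S \<le> b"
  shows "sup_miss_prob d s a \<sigma> S \<le> b"
  unfolding sup_miss_prob_def using zero_in_Theta[of d s a] assms by (intro cSUP_least) blast+

lemma sup_miss_prob_nonneg: "0 < \<sigma> \<Longrightarrow> 0 \<le> sup_miss_prob d s a \<sigma> S"
  using miss_prob_le_sup[OF _ zero_in_Theta] miss_prob_nonneg order_trans by blast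

lemma empty_in_selectors: "\<delta> \<le> 1 \<Longrightarrow> (\<lambda>_. {}) \<in> selectors d \<sigma> \<delta>"
  by (simp add: selectors_def)

text \<open>The empty selector serves as a competitor in the infimum.\<close>

lemma minimax_risk_le_1:
  assumes "0 < \<sigma>" "\<delta> \<le> 1"
  shows "minimax_risk d s a \<sigma> \<delta> \<le> 1"
proof -
  have "minimax_risk d s a \<sigma> \<delta> \<le> sup_miss_prob d s a \<sigma> (\<lambda>_. {})"
    unfolding minimax_risk_def using assms sup_miss_prob_nonneg empty_in_selectors
    by (intro cINF_lower bdd_belowI2[of _ 0]) auto
  also have "\<dots> \<le> 1"
    using assms by (intro sup_miss_prob_le miss_prob_le_1)
  finally show ?thesis .
qed

text \<open>The sigma-algebra generated by one coordinate consists of preimages of Borel sets. This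
  reduces a selector to one-dimensional acceptance regions whose level is that of the centred normal
  law.\<close>

lemma selectors_cylinder:
  assumes "S \<in> selectors d \<sigma> \<delta>" "0 < \<sigma>"
  obtains A where "\<And>j. A j \<in> sets borel"
    "\<And>x j. x \<in> {1..d} \<rightarrow>\<^sub>E UNIV \<Longrightarrow> j \<in> {1..d} \<Longrightarrow> j \<in> S x \<longleftrightarrow> x j \<in> A j"
    "\<And>j. j \<in> {1..d} \<Longrightarrow> measure (normal_law 0 \<sigma>) (A j) \<le> 1 - \<delta>"
proof -
  let ?X = "{1..d} \<rightarrow>\<^sub>E (UNIV :: real set)"
  have "\<exists>A. \<forall>j. A j \<in> sets borel \<and> (j \<in> {1..d} \<longrightarrow> {x \<in> ?X. j \<in> S x} = {x \<in> ?X. x j \<in> A j})"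
  proof (intro choice allI)
    fix j
    show "\<exists>A. A \<in> sets borel \<and> (j \<in> {1..d} \<longrightarrow> {x \<in> ?X. j \<in> S x} = {x \<in> ?X. x j \<in> A})"
    proof (cases "j \<in> {1..d}")
      case True
      then have "{x \<in> ?X. j \<in> S x} \<in> {(\<lambda>x. x j) -` A \<inter> ?X | A. A \<in> sets borel}"
        using assms(1) by (subst sets_vimage_algebra2[symmetric]) (auto simp: selectors_def)
      then obtain A where "A \<in> sets borel" "{x \<in> ?X. j \<in> S x} = (\<lambda>x. x j) -` A \<inter> ?X"
        by blast
      then show ?thesis
        by (intro exI[of _ A]) auto
    \<comment> \<open>For indices outside \<open>{1..d}\<close> the region is empty, so
      \<open>A\<close> is Borel everywhere.\<close>
    qed (auto intro: exI[of _ "{}"])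
  qed
  then obtain A
    where *: "\<forall>j. A j \<in> sets borel \<and> (j \<in> {1..d} \<longrightarrow> {x \<in> ?X. j \<in> S x} = {x \<in> ?X. x j \<in> A j})"
    by (rule exE)
  then have A: "A j \<in> sets borel" for j
    by simp
  from * have SA: "{x \<in> ?X. j \<in> S x} = {x \<in> ?X. x j \<in> A j}" if "j \<in> {1..d}" for j
    using that by simp
  have "measure (normal_law 0 \<sigma>) (A j) \<le> 1 - \<delta>" if "j \<in> {1..d}" for j
  proof -
    have "measure (obs_law d \<sigma> (\<lambda>i\<in>{1..d}. 0)) {x \<in> ?X. j \<in> S x} \<le> 1 - \<delta>"
      using assms(1) that by (auto simp: selectors_def)
    moreover have "{x \<in> ?X. j \<in> S x} = {x \<in> ?X. \<forall>i\<in>{j}. x i \<in> A i}"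
      using SA[OF that] by simp
    ultimately show ?thesis
      using measure_obs_law_cylinder[of \<sigma> "{j}" d A "\<lambda>i\<in>{1..d}. 0"] A assms(2) that by simp
  qed
  moreover have "j \<in> S x \<longleftrightarrow> x j \<in> A j" if "x \<in> ?X" "j \<in> {1..d}" for x j
  proof -
    have "x \<in> {x \<in> ?X. j \<in> S x} \<longleftrightarrow> x \<in> {x \<in> ?X. x j \<in> A j}"
      by (simp only: SA[OF that(2)])
    then show ?thesis
      using that(1) by simp
  qed
  ultimately show thesis
    using A by (intro that[of A])
qed

section \<open>The non-asymptotic lower bound\<close>

lemma Phi_quantile:
  assumes "0 < \<delta>" "\<delta> < 1"
  shows "Phi (Phi_inv ((1 + \<delta>) / 2)) = (1 + \<delta>) / 2" "0 < Phi_inv ((1 + \<delta>) / 2)"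
  using assms by (simp_all add: Phi_Phi_inv Phi_inv_pos_iff)

text \<open>Each tail has mass \<open>(1 - \<delta>) / 2\<close>, so the two-sided test exhausts the
  level allowed to a selector.\<close>

lemma null_level:
  assumes "0 < \<sigma>" "0 < \<delta>" "\<delta> < 1"
  shows "measure (normal_law 0 \<sigma>) {x. Phi_inv ((1 + \<delta>) / 2) \<le> \<bar>x\<bar> / \<sigma>} = 1 - \<delta>"
  using Phi_quantile[OF assms(2,3)] assms
  by (simp add: measure_normal_law_abs_ge Phi_minus)

text \<open>By symmetry the two-sided test has power \<open>1 - Delta_TS a \<sigma> \<delta>\<close>
  under either sign. The Neyman-Pearson bound on the sum then forces one of the two signs to obey
  the bound.\<close>

lemma sign_detection_bound:
  assumes "0 < \<sigma>" "0 < a" "0 < \<delta>" "\<delta> < 1" and A: "A \<in> sets borel"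
    and level: "measure (normal_law 0 \<sigma>) A \<le> 1 - \<delta>"
  shows "\<exists>\<mu>\<in>{a, - a}. measure (normal_law \<mu> \<sigma>) A \<le> 1 - Delta_TS a \<sigma> \<delta>"
proof -
  define t where "t = Phi_inv ((1 + \<delta>) / 2)"
  have t: "0 \<le> t"
    using Phi_quantile[of \<delta>] assms by (simp add: t_def)
  have "measure (normal_law \<mu> \<sigma>) {x. t \<le> \<bar>x\<bar> / \<sigma>} = 1 - Delta_TS a \<sigma> \<delta>" if "\<mu> \<in> {a, - a}" for \<mu>
    using that Phi_minus[of "- t + a / \<sigma>"] Phi_minus[of "t + a / \<sigma>"] 
    by (auto simp: measure_normal_law_abs_ge[OF assms(1) t] Delta_TS_def simp flip: t_def)
  then show ?thesis
    using neyman_pearson_symmetric_normal[OF assms(1,2) t A] level null_level[of \<sigma> \<delta>] assms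
    by (fastforce simp flip: t_def)
qed

lemma Delta_TS_bounds:
  assumes "0 < \<sigma>" "0 < a" "0 < \<delta>" "\<delta> < 1"
  shows "0 \<le> Delta_TS a \<sigma> \<delta>" "Delta_TS a \<sigma> \<delta> \<le> 1"
  using Phi_quantile[of \<delta>] assms Phi_nonneg[of "- Phi_inv ((1 + \<delta>) / 2) + a / \<sigma>"]
    Phi_le_1[of "Phi_inv ((1 + \<delta>) / 2) + a / \<sigma>"]
  by (simp_all add: Delta_TS_def)

text \<open>The parameter is chosen adversarially once the acceptance regions are known;
  independence turns the coordinatewise bounds into an \<open>s\<close>-th power.\<close>

lemma sup_miss_prob_ge:
  assumes "s \<le> d" "0 < a" "0 < \<sigma>" "0 < \<delta>" "\<delta> < 1" and S: "S \<in> selectors d \<sigma> \<delta>"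
  shows "1 - (1 - Delta_TS a \<sigma> \<delta>) ^ s \<le> sup_miss_prob d s a \<sigma> S"
proof -
  let ?X = "{1..d} \<rightarrow>\<^sub>E (UNIV :: real set)"
  obtain A where A: "\<And>j. A j \<in> sets borel"
    and SA: "\<And>x j. x \<in> ?X \<Longrightarrow> j \<in> {1..d} \<Longrightarrow> j \<in> S x \<longleftrightarrow> x j \<in> A j"
    and level: "\<And>j. j \<in> {1..d} \<Longrightarrow> measure (normal_law 0 \<sigma>) (A j) \<le> 1 - \<delta>"
    using selectors_cylinder[OF S assms(3)] by metis
  have "\<forall>j\<in>{1..d}. \<exists>\<mu>\<in>{a, - a}. measure (normal_law \<mu> \<sigma>) (A j) \<le> 1 - Delta_TS a \<sigma> \<delta>"
    using sign_detection_bound[of \<sigma> a \<delta>] assms A level by blast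
  then obtain e where e: "\<And>j. j \<in> {1..d} \<Longrightarrow> e j \<in> {a, - a}"
    "\<And>j. j \<in> {1..d} \<Longrightarrow> measure (normal_law (e j) \<sigma>) (A j) \<le> 1 - Delta_TS a \<sigma> \<delta>"
    by metis
  \<comment> \<open>Exactly \<open>s\<close> nonzero entries of modulus \<open>a\<close>, each with
    the sign that is harder to detect.\<close>
  define \<theta> where "\<theta> = (\<lambda>j\<in>{1..d}. if j \<le> s then e j else 0)"
  have supp: "supp d \<theta> = {1..s}"
  proof -
    have "e j \<noteq> 0" if "j \<in> {1..d}" for j
      using e(1)[OF that] assms(2) by auto
    then show ?thesis
      using assms(1) by (auto simp: supp_def \<theta>_def)
  qed
  have "\<bar>\<theta> j\<bar> = a" if "j \<in> {1..s}" for j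
    using that e(1)[of j] assms(1,2) by (auto simp: \<theta>_def)
  then have "\<theta> \<in> Theta d s a"
    by (simp add: Theta_def supp) (simp add: \<theta>_def)
  interpret prob_space "obs_law d \<sigma> \<theta>"
    using assms(3) by (rule prob_space_obs_law)
  let ?H = "{x \<in> ?X. \<forall>j\<in>{1..s}. x j \<in> A j}"
  have covers: "supp d \<theta> \<subseteq> S x \<longleftrightarrow> (\<forall>j\<in>{1..s}. x j \<in> A j)" if "x \<in> ?X" for x
    unfolding supp subset_eq using SA[OF that] assms(1) by (intro ball_cong) auto
  have "{x \<in> ?X. \<not> supp d \<theta> \<subseteq> S x} = space (obs_law d \<sigma> \<theta>) - ?H"
    unfolding space_obs_law
  proof (rule set_eqI)
    fix x
    show "x \<in> {x \<in> ?X. \<not> supp d \<theta> \<subseteq> S x} \<longleftrightarrow> x \<in> ?X - ?H"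
      using covers[of x] by (cases "x \<in> ?X") simp_all
  qed
  moreover have "prob ?H \<le> (1 - Delta_TS a \<sigma> \<delta>) ^ s"
  proof -
    have "prob ?H = (\<Prod>j\<in>{1..s}. measure (normal_law (\<theta> j) \<sigma>) (A j))"
      using A assms by (intro measure_obs_law_cylinder) auto
    also have "\<dots> \<le> (\<Prod>j\<in>{1..s}. 1 - Delta_TS a \<sigma> \<delta>)"
      using e(2) assms(1) by (intro prod_mono) (auto simp: \<theta>_def)
    finally show ?thesis by simp
  qed
  ultimately have "1 - (1 - Delta_TS a \<sigma> \<delta>) ^ s \<le> miss_prob d \<sigma> \<theta> S"
    using sets_obs_law_cylinder[of "{1..s}" d A \<sigma> \<theta>] A assms(1)
    by (simp add: miss_prob_def prob_compl)
  also have "\<dots> \<le> sup_miss_prob d s a \<sigma> S"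
    using assms \<open>\<theta> \<in> Theta d s a\<close> by (intro miss_prob_le_sup)
  finally show ?thesis .
qed

lemma minimax_risk_ge:
  assumes "s \<le> d" "0 < a" "0 < \<sigma>" "0 < \<delta>" "\<delta> < 1"
  shows "1 - 1 / (Delta_TS a \<sigma> \<delta> + 1) ^ s \<le> minimax_risk d s a \<sigma> \<delta>"
proof -
  define D where "D = Delta_TS a \<sigma> \<delta>"
  have D: "0 \<le> D" "D \<le> 1"
    using Delta_TS_bounds assms by (simp_all add: D_def)
  \<comment> \<open>The product is one minus the square of \<open>D\<close>; its \<open>s\<close>-th
    power converts the sharper bound into the stated one.\<close>
  have "(1 - D) * (D + 1) \<le> 1"
    by (simp add: algebra_simps)
  then have "((1 - D) * (D + 1)) ^ s \<le> 1"
    using D by (intro power_le_one) auto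
  then have "(1 - D) ^ s \<le> 1 / (D + 1) ^ s"
    using D by (simp add: power_mult_distrib pos_le_divide_eq)
  moreover have "1 - (1 - D) ^ s \<le> minimax_risk d s a \<sigma> \<delta>"
    unfolding minimax_risk_def D_def
  proof (rule cINF_greatest)
    show "selectors d \<sigma> \<delta> \<noteq> {}"
      using empty_in_selectors[of \<delta> d \<sigma>] assms(5) by auto
  qed (rule sup_miss_prob_ge[OF assms])
  ultimately show ?thesis
    by (simp add: D_def)
qed

section \<open>The two-sided thresholding selector\<close>

lemma S_TS_iff:
  "j \<in> S_TS d s a \<sigma> \<delta> \<alpha> x \<longleftrightarrow> j \<in> {1..d} \<and>
    x j \<in> {y. max (max (Phi_inv (\<alpha> / (2 * real s)) + a / \<sigma>) 0) (Phi_inv ((1 + \<delta>) / 2)) \<le> \<bar>y\<bar> / \<sigma>}"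
  by (simp add: S_TS_def)

text \<open>The threshold is at least the quantile \<open>t\<close>, so each acceptance region lies
  inside the two-sided test of null probability \<open>1 - \<delta>\<close>.\<close>

lemma S_TS_in_selectors:
  assumes "0 < \<sigma>" "0 < \<delta>" "\<delta> < 1"
  shows "S_TS d s a \<sigma> \<delta> \<alpha> \<in> selectors d \<sigma> \<delta>"
  unfolding selectors_def
proof (intro CollectI conjI ballI)
  define t where "t = Phi_inv ((1 + \<delta>) / 2)"
  define r where "r = max (max (Phi_inv (\<alpha> / (2 * real s)) + a / \<sigma>) 0) t"
  define A where "A = {y. r \<le> \<bar>y\<bar> / \<sigma>}"
  have A: "A \<in> sets borel"
    unfolding A_def by measurable
  fix j assume j: "j \<in> {1..d}"
  have eq: "{x \<in> {1..d} \<rightarrow>\<^sub>E UNIV. j \<in> S_TS d s a \<sigma> \<delta> \<alpha> x} = {x \<in> {1..d} \<rightarrow>\<^sub>E UNIV. \<forall>i\<in>{j}. x i \<in> A}"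
    using j by (auto simp: S_TS_iff A_def r_def t_def)
  show "{x \<in> {1..d} \<rightarrow>\<^sub>E UNIV. j \<in> S_TS d s a \<sigma> \<delta> \<alpha> x}
      \<in> sets (vimage_algebra ({1..d} \<rightarrow>\<^sub>E UNIV) (\<lambda>x. x j) borel)"
    using in_vimage_algebra[OF A, of "\<lambda>x. x j" "{1..d} \<rightarrow>\<^sub>E UNIV"]
    unfolding eq by (simp add: vimage_def Int_def conj_commute)
  interpret prob_space "normal_law 0 \<sigma>"
    using assms(1) by (rule prob_space_normal_density)
  have "measure (obs_law d \<sigma> (\<lambda>i\<in>{1..d}. 0)) {x \<in> {1..d} \<rightarrow>\<^sub>E UNIV. j \<in> S_TS d s a \<sigma> \<delta> \<alpha> x}
      = measure (normal_law 0 \<sigma>) A"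
    unfolding eq using measure_obs_law_cylinder[of \<sigma> "{j}" d "\<lambda>_. A"] assms A j by simp
  also have "\<dots> \<le> measure (normal_law 0 \<sigma>) {y. t \<le> \<bar>y\<bar> / \<sigma>}"
    by (intro finite_measure_mono) (auto simp: A_def r_def)
  also have "\<dots> = 1 - \<delta>"
    unfolding t_def using assms by (rule null_level)
  finally show "measure (obs_law d \<sigma> (\<lambda>i\<in>{1..d}. 0))
      {x \<in> {1..d} \<rightarrow>\<^sub>E UNIV. j \<in> S_TS d s a \<sigma> \<delta> \<alpha> x} \<le> 1 - \<delta>" .
qed (auto simp: S_TS_def)

text \<open>A union bound over at most \<open>s\<close> support points, each missed with probability
  at most \<open>\<alpha> / (2 * real s)\<close>; this yields half of the permitted error.\<close>

lemma sup_miss_prob_S_TS_le: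
  assumes "1 \<le> s" "0 < \<sigma>" "0 < \<delta>" "\<delta> < 1" "0 < \<alpha>" "\<alpha> < 1"
    and gap: "Phi_inv ((1 + \<delta>) / 2) - Phi_inv (\<alpha> / (2 * real s)) \<le> a / \<sigma>"
  shows "sup_miss_prob d s a \<sigma> (S_TS d s a \<sigma> \<delta> \<alpha>) \<le> \<alpha> / 2"
proof (rule sup_miss_prob_le)
  fix \<theta> assume \<theta>: "\<theta> \<in> Theta d s a"
  let ?X = "{1..d} \<rightarrow>\<^sub>E (UNIV :: real set)"
  define p where "p = \<alpha> / (2 * real s)"
  have p: "0 < p" "p < 1"
    using assms by (auto simp: p_def field_simps)
  define r where "r = Phi_inv p + a / \<sigma>"
  \<comment> \<open>The gap condition says that \<open>r\<close> is at least the positive quantile,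
    so both maxima collapse to \<open>r\<close>.\<close>
  have r: "0 < r" "max (max (Phi_inv (\<alpha> / (2 * real s)) + a / \<sigma>) 0) (Phi_inv ((1 + \<delta>) / 2)) = r"
    using gap Phi_quantile(2)[of \<delta>] assms by (auto simp: r_def p_def)
  interpret prob_space "obs_law d \<sigma> \<theta>"
    using assms(2) by (rule prob_space_obs_law)
  let ?M = "\<lambda>j. {x \<in> ?X. \<forall>i\<in>{j}. x i \<in> {y. \<bar>y\<bar> / \<sigma> < r}}"
  have sub: "supp d \<theta> \<subseteq> {1..d}"
    by (auto simp: supp_def)
  then have fin: "finite (supp d \<theta>)"
    using finite_subset by blast
  have "{x \<in> ?X. \<not> supp d \<theta> \<subseteq> S_TS d s a \<sigma> \<delta> \<alpha> x} = (\<Union>j\<in>supp d \<theta>. ?M j)"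
    using sub unfolding subset_eq S_TS_iff r(2) by (auto simp: not_le)
  moreover have "?M j \<in> events" if "j \<in> supp d \<theta>" for j
    using that sub by (intro sets_obs_law_cylinder) auto
  ultimately have "miss_prob d \<sigma> \<theta> (S_TS d s a \<sigma> \<delta> \<alpha>) \<le> (\<Sum>j\<in>supp d \<theta>. prob (?M j))"
    unfolding miss_prob_def using finite_measure_subadditive_finite[OF fin, of ?M]
    by (simp add: image_subset_iff)
  also have "\<dots> \<le> (\<Sum>j\<in>supp d \<theta>. p)"
  proof (rule sum_mono)
    fix j assume j: "j \<in> supp d \<theta>"
    have "prob (?M j) = measure (normal_law (\<theta> j) \<sigma>) {y. \<bar>y\<bar> / \<sigma> < r}"
      using measure_obs_law_cylinder[of \<sigma> "{j}" d "\<lambda>_. {y. \<bar>y\<bar> / \<sigma> < r}" \<theta>] assms j sub by auto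
    also have "\<dots> \<le> Phi (r - \<bar>\<theta> j\<bar> / \<sigma>)"
      using assms r by (intro measure_normal_law_abs_less_le) auto
    \<comment> \<open>Support entries have modulus at least \<open>a\<close>, which absorbs the
      shift \<open>a / \<sigma>\<close> in \<open>r\<close>.\<close>
    also have "\<dots> \<le> Phi (Phi_inv p)"
      using \<theta> j assms(2) by (auto simp: r_def Theta_def divide_right_mono)
    finally show "prob (?M j) \<le> p"
      using p by (simp add: Phi_Phi_inv)
  qed
  also have "\<dots> \<le> real s * p"
    using \<theta> p by (auto simp: Theta_def intro!: mult_right_mono)
  also have "\<dots> = \<alpha> / 2"
    using assms(1) by (simp add: p_def)
  finally show "miss_prob d \<sigma> \<theta> (S_TS d s a \<sigma> \<delta> \<alpha>) \<le> \<alpha> / 2" .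
qed

section \<open>The asymptotic lower bound\<close>

text \<open>\<open>Delta_TS\<close> is the mass of a window of half-width \<open>t\<close> centred
  at \<open>a / \<sigma>\<close>. At the largest permitted centre \<open>t + q\<close> the window
  runs from \<open>q\<close> to \<open>q + 2 * t\<close>. The tail beyond \<open>q\<close> has mass
  \<open>p\<close>, and \<open>Phi_tail_shift\<close> bounds the part left beyond
  \<open>q + 2 * t\<^sub>0\<close> by a fixed fraction of it.\<close>

lemma Delta_TS_ge:
  assumes "0 < \<sigma>" "0 < a" "0 < \<delta>\<^sub>0" "\<delta>\<^sub>0 \<le> \<delta>" "\<delta> < 1" "0 < p" "p \<le> 1 / 2"
    and le: "a / \<sigma> \<le> Phi_inv ((1 + \<delta>) / 2) - Phi_inv p"
  shows "(1 - exp (- (2 * Phi_inv ((1 + \<delta>\<^sub>0) / 2))\<^sup>2 / 2)) * p \<le> Delta_TS a \<sigma> \<delta>"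
proof -
  define t where "t = Phi_inv ((1 + \<delta>) / 2)"
  define t\<^sub>0 where "t\<^sub>0 = Phi_inv ((1 + \<delta>\<^sub>0) / 2)"
  define q where "q = - Phi_inv p"
  have t: "0 \<le> t\<^sub>0" "t\<^sub>0 \<le> t"
    using Phi_quantile[of \<delta>\<^sub>0] assms by (auto simp: t_def t\<^sub>0_def intro!: Phi_inv_mono)
  \<comment> \<open>The condition \<open>p <= 1 / 2\<close> makes \<open>q\<close> nonnegative, as
    the tail comparison demands.\<close>
  have q: "0 \<le> q" "1 - Phi q = p"
    using Phi_inv_pos_iff[of p] assms by (auto simp: q_def Phi_minus Phi_Phi_inv)
  have "p - exp (- (2 * t\<^sub>0)\<^sup>2 / 2) * p \<le> p - (1 - Phi (q + 2 * t\<^sub>0))"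
    using Phi_tail_shift[of q "2 * t\<^sub>0"] q t by simp
  also have "\<dots> = Phi (q + 2 * t\<^sub>0) - Phi q"
    using q by simp
  also have "\<dots> \<le> Phi (q + 2 * t) - Phi q"
    using t by simp
  also have "\<dots> = Phi (t + (t + q)) - Phi (- t + (t + q))"
    by (simp add: algebra_simps)
  also have "\<dots> \<le> Delta_TS a \<sigma> \<delta>"
    unfolding Delta_TS_def t_def[symmetric] using assms t le
    by (intro Phi_window_antimono) (auto simp: t_def q_def)
  finally show ?thesis
    by (simp add: t\<^sub>0_def algebra_simps)
qed

lemma filterlim_snd_ds_at_top: "filterlim snd at_top ds_at_top"
  unfolding ds_at_top_def by (rule filterlim_mono[OF filterlim_snd order_refl inf_le1])

lemma eventually_ds_at_top_le: "\<forall>\<^sub>F (d, s) in ds_at_top. s \<le> d"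
  by (simp add: ds_at_top_def eventually_inf_principal)

text \<open>Pairs with \<open>s <= d\<close> occur arbitrarily far out. Nontriviality lets the limit
  determine the \<open>Liminf\<close>.\<close>

lemma ds_at_top_neq_bot: "ds_at_top \<noteq> bot"
proof
  assume "ds_at_top = bot"
  then have "eventually (\<lambda>_. False) ds_at_top"
    by simp
  then show False
    unfolding ds_at_top_def eventually_inf_principal eventually_prod_sequentially by auto
qed

text \<open>The risk is squeezed between \<open>1 - inverse (1 + \<kappa> * c s)\<close> and 1,
  where \<open>\<kappa>\<close> depends on the lower bound for \<open>\<delta>\<close>
  alone.\<close>

lemma minimax_risk_tendsto_1:
  assumes range: "\<And>d s. 1 \<le> s \<Longrightarrow> s \<le> d \<Longrightarrow> 0 < a d s \<and> 0 < \<sigma> d s \<and> \<delta>\<^sub>0 \<le> \<delta> d s \<and> \<delta> d s < 1"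
    and "0 < \<delta>\<^sub>0" and c: "filterlim c at_top sequentially" "(\<lambda>s. c s / real s) \<longlonglongrightarrow> 0"
    and le: "\<forall>\<^sub>F (d, s) in ds_at_top.
      a d s / \<sigma> d s \<le> Phi_inv ((1 + \<delta> d s) / 2) - Phi_inv (c s / real s)"
  shows "((\<lambda>(d, s). minimax_risk d s (a d s) (\<sigma> d s) (\<delta> d s)) \<longlongrightarrow> 1) ds_at_top"
proof (rule tendsto_sandwich)
  define \<kappa> where "\<kappa> = 1 - exp (- (2 * Phi_inv ((1 + \<delta>\<^sub>0) / 2))\<^sup>2 / 2)"
  have \<delta>\<^sub>0: "\<delta>\<^sub>0 < 1"
    using range[of 1 1] by auto
  have \<kappa>: "0 < \<kappa>"
    using Phi_quantile(2)[OF assms(2) \<delta>\<^sub>0] by (simp add: \<kappa>_def)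
  \<comment> \<open>These conditions make \<open>c s / real s\<close> an admissible \<open>p\<close>
    in \<open>Delta_TS_ge\<close>.\<close>
  have "\<forall>\<^sub>F s in sequentially. 1 \<le> s \<and> 0 < c s \<and> c s / real s < 1 / 2"
    using eventually_ge_at_top[of 1] filterlim_at_top_dense[THEN iffD1, OF c(1), rule_format, of 0]
      order_tendstoD(2)[OF c(2), of "1 / 2"] by (simp add: eventually_conj_iff)
  then have "\<forall>\<^sub>F x in ds_at_top. 1 \<le> snd x \<and> 0 < c (snd x) \<and> c (snd x) / real (snd x) < 1 / 2"
    by (rule eventually_compose_filterlim[OF _ filterlim_snd_ds_at_top])
  with le eventually_ds_at_top_le
  show "\<forall>\<^sub>F x in ds_at_top. 1 - inverse (1 + \<kappa> * c (snd x))
      \<le> (case x of (d, s) \<Rightarrow> minimax_risk d s (a d s) (\<sigma> d s) (\<delta> d s))"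
  proof eventually_elim
    case (elim x)
    obtain d s where x: "x = (d, s)"
      by fastforce
    note elim = elim[unfolded x, simplified]
    define D where "D = Delta_TS (a d s) (\<sigma> d s) (\<delta> d s)"
    from elim have ds: "1 \<le> s" "s \<le> d"
      by auto
    note rg = range[OF ds]
    have "\<kappa> * (c s / real s) \<le> D"
      unfolding \<kappa>_def D_def using rg elim assms(2) by (intro Delta_TS_ge) auto
    then have "\<kappa> * c s \<le> real s * D"
      using ds by (simp add: field_simps)
    then have "1 + \<kappa> * c s \<le> 1 + real s * D"
      by simp
    \<comment> \<open>Bernoulli's inequality turns the bound on \<open>s * D\<close> into growth of
      the power.\<close>
    also have "\<dots> \<le> (1 + D) ^ s"
      using Delta_TS_bounds(1)[of "\<sigma> d s" "a d s" "\<delta> d s"] rg assms(2)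
      by (intro Bernoulli_inequality) (auto simp: D_def)
    finally have "1 / (D + 1) ^ s \<le> inverse (1 + \<kappa> * c s)"
      using \<kappa> elim by (simp add: inverse_eq_divide add.commute frac_le add_pos_pos)
    then show ?case
      using minimax_risk_ge[of s d "a d s" "\<sigma> d s" "\<delta> d s"] rg ds assms(2) by (simp add: x D_def)
  qed
  show "\<forall>\<^sub>F x in ds_at_top. (case x of (d, s) \<Rightarrow> minimax_risk d s (a d s) (\<sigma> d s) (\<delta> d s)) \<le> 1"
    using eventually_ds_at_top_le
      eventually_compose_filterlim[OF eventually_ge_at_top[of 1] filterlim_snd_ds_at_top]
    by eventually_elim (use range in \<open>auto intro!: minimax_risk_le_1 simp: less_imp_le\<close>)
  have "filterlim (\<lambda>s. 1 + \<kappa> * c s) at_top sequentially"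
    using \<kappa> by (intro filterlim_tendsto_add_at_top[OF tendsto_const]
        filterlim_tendsto_pos_mult_at_top[OF tendsto_const] c)
  then have "((\<lambda>s. 1 - inverse (1 + \<kappa> * c s)) \<longlongrightarrow> 1 - 0) sequentially"
    by (intro tendsto_diff tendsto_const tendsto_inverse_0_at_top)
  then show "((\<lambda>x. 1 - inverse (1 + \<kappa> * c (snd x))) \<longlongrightarrow> 1) ds_at_top"
    using filterlim_compose[of "\<lambda>s. 1 - inverse (1 + \<kappa> * c s)", OF _ filterlim_snd_ds_at_top]
    by simp
qed auto

theorem theorem5p1:
  shows
    "(\<forall>(d::nat) (s::nat) (a::real) (\<sigma>::real) (\<delta>::real).
        1 \<le> s \<and> s \<le> d \<and> 0 < a \<and> 0 < \<sigma> \<and> 0 < \<delta> \<and> \<delta> < 1 \<longrightarrow>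
        minimax_risk d s a \<sigma> \<delta> \<ge> 1 - 1 / (Delta_TS a \<sigma> \<delta> + 1) ^ s)
   \<and> (\<forall>(a :: nat \<Rightarrow> nat \<Rightarrow> real) (\<sigma> :: nat \<Rightarrow> nat \<Rightarrow> real) (\<delta> :: nat \<Rightarrow> nat \<Rightarrow> real)
         (c :: nat \<Rightarrow> real) (c0 :: real).
        (\<forall>d s. 1 \<le> s \<and> s \<le> d \<longrightarrow> 0 < a d s \<and> 0 < \<sigma> d s \<and> 0 < \<delta> d s \<and> \<delta> d s < 1) \<and>
        filterlim c at_top sequentially \<and>
        (\<lambda>s. c s / real s) \<longlonglongrightarrow> 0 \<and>
        0 < c0 \<and> (\<forall>d s. 1 \<le> s \<and> s \<le> d \<longrightarrow> c0 \<le> \<delta> d s) \<and>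
        (\<forall>\<^sub>F (d, s) in ds_at_top.
           a d s / \<sigma> d s \<le> Phi_inv ((1 + \<delta> d s) / 2) - Phi_inv (c s / real s)) \<longrightarrow>
        Liminf ds_at_top (\<lambda>(d, s). ereal (minimax_risk d s (a d s) (\<sigma> d s) (\<delta> d s))) = 1)
   \<and> (\<forall>(d::nat) (s::nat) (a::real) (\<sigma>::real) (\<delta>::real) (\<alpha>::real).
        1 \<le> s \<and> s \<le> d \<and> 0 < a \<and> 0 < \<sigma> \<and> 0 < \<delta> \<and> \<delta> < 1 \<and> 0 < \<alpha> \<and> \<alpha> < 1 \<longrightarrow>
        S_TS d s a \<sigma> \<delta> \<alpha> \<in> selectors d \<sigma> \<delta> \<and>
        (a / \<sigma> \<ge> Phi_inv ((\<delta> + 1) / 2) - Phi_inv (\<alpha> / (2 * real s)) \<longrightarrow>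
           sup_miss_prob d s a \<sigma> (S_TS d s a \<sigma> \<delta> \<alpha>) \<le> \<alpha>))"
proof (intro conjI allI impI, goal_cases)
  case (1 d s a \<sigma> \<delta>)
  then show ?case
    by (intro minimax_risk_ge) auto
next
  case (2 a \<sigma> \<delta> c c0)
  then have "((\<lambda>(d, s). minimax_risk d s (a d s) (\<sigma> d s) (\<delta> d s)) \<longlongrightarrow> 1) ds_at_top"
    by (intro minimax_risk_tendsto_1[of a \<sigma> c0 \<delta> c]) auto
  then have "((\<lambda>(d, s). ereal (minimax_risk d s (a d s) (\<sigma> d s) (\<delta> d s))) \<longlongrightarrow> ereal 1) ds_at_top"
    unfolding case_prod_unfold by (rule tendsto_ereal)
  then show ?case
    unfolding one_ereal_def by (rule lim_imp_Liminf[OF ds_at_top_neq_bot])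
next
  case (3 d s a \<sigma> \<delta> \<alpha>)
  then show ?case
    by (intro S_TS_in_selectors) auto
next
  case (4 d s a \<sigma> \<delta> \<alpha>)
  then have "sup_miss_prob d s a \<sigma> (S_TS d s a \<sigma> \<delta> \<alpha>) \<le> \<alpha> / 2"
    by (intro sup_miss_prob_S_TS_le) (auto simp: add.commute)
  with 4 show ?case
    by simp
qed

end
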